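(* Let $\pi^{*,\mathrm{RLHF}}_\alpha$ be the policy with $\pi^{*,\mathrm{RLHF}}_\alpha(\cdot\mid x)=\arg\max_\pi V_\alpha^{\pi,\mathrm{RLHF}}(x)$ for every $x\in\mathcal X$ (i.e. the policy maximizing the regularized value simultaneously at every state). Let $(\pi_t)_{t\ge1}$ be the policies produced by the multi-turn RLHF algorithm with learning rates $\eta_t=\frac{2}{\alpha(t+2)}$, and let $\mathbb Q$ be a bound on the magnitude of the Q-functions, i.e. $|Q_\alpha^{\pi_t,\mathrm{RLHF}}(x,y)|\le\mathbb Q$ for all $t\ge1$, all non-terminal states $x$ and all $y\in\mathcal Y$. Then for every iteration $t\ge1$, $$\mathrm{KL}_p(\pi^{*,\mathrm{RLHF}}_\alpha\,\|\,\pi_t)\le\frac{32\,H\,\mathbb Q^2}{\alpha^2(t+1)}.$$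
   Context: MDP. Fix a finite-horizon MDP with horizon $H\ge1$, finite state space $\mathcal X=\bigsqcup_{h=1}^{H+1}\mathcal X_h$ (disjoint union), finite action space $\mathcal Y$, initial state $x_1\in\mathcal X_1$, and transition function $p$, where for $x_h\in\mathcal X_h$ ($h\le H$) and $y_h\in\mathcal Y$, $p(\cdot\mid x_h,y_h)$ is a probability distribution on $\mathcal X_{h+1}$. A policy $\pi$ assigns to each non-terminal state $x$ (i.e. $x\in\mathcal X_h$, $h\le H$) a probability distribution $\pi(\cdot\mid x)$ on $\mathcal Y$. $\mathbb E_{\pi,p}$ refers to the random trajectory $(x_1,y_1,\dots,x_H,y_H,x_{H+1})$ with $y_h\sim\pi(\cdot\mid x_h)$, $x_{h+1}\sim p(\cdot\mid x_h,y_h)$; conditioning on $x_h$ (resp. $x_h,y_h$) means the trajectory is started at $x_h$ (resp. at $x_h$ with action $y_h$) and continued with $\pi,p$. KL. $\mathrm{KL}(\pi\|\pi')[x]=\sum_{y}\pi(y\mid x)\log\frac{\pi(y\mid x)}{\pi'(y\mid x)}$. $\mathrm{KL}_p(\pi\|\pi')$ is the KL divergence between the distributions over trajectories induced by $\pi$ and by $\pi'$ (with the same $p$). Regularized values. Fix a reference policy $\mu$, a coefficient $\alpha>0$ and a fixed reward function $r^{\mathrm{RLHF}}:\mathcal X_{H+1}\to\mathbb R$ (in the application, learned from preference data). All policies considered satisfy $\pi(y\mid x)=0$ whenever $\mu(y\mid x)=0$. Define $Q_\alpha^{\pi,\mathrm{RLHF}}(x_h,y_h)=\mathbb E_{\pi,p}\big[r^{\mathrm{RLHF}}(x_{H+1})-\alpha\sum_{h'=h}^H\mathrm{KL}(\pi\|\mu)[x_{h'}]\,\big|\,x_h,y_h\big]$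 and $V_\alpha^{\pi,\mathrm{RLHF}}(x_h)$ as the same expectation conditioned only on $x_h$. Multi-turn RLHF algorithm. $\pi_1=\mu$ and, for $t\ge1$ and every non-terminal state $x$, $$\pi_{t+1}(\cdot\mid x)=\arg\max_{\pi(\cdot\mid x)}\ \eta_t\sum_y\pi(y\mid x)Q_\alpha^{\pi_t,\mathrm{RLHF}}(x,y)-\alpha\eta_t\mathrm{KL}(\pi\|\mu)[x]-(1-\alpha\eta_t)\mathrm{KL}(\pi\|\pi_t)[x],$$ equivalently $\pi_{t+1}(y\mid x)\propto\mu(y\mid x)^{\alpha\eta_t}\pi_t(y\mid x)^{1-\alpha\eta_t}e^{\eta_tQ_\alpha^{\pi_t,\mathrm{RLHF}}(x,y)}$. *)

theory Defs
  imports "HOL-Probability.Probability" "HOL-Probability.Information"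
begin

(* The action space is a finite type; the stages X 1, ..., X (H + 1) are finite sets of states.
   The values of kernels and policies outside the relevant stages are irrelevant. *)
locale finite_horizon_mdp =
  fixes H :: nat and X :: "nat \<Rightarrow> 'x set" and x1 :: 'x
    and p :: "'x \<Rightarrow> 'y::finite \<Rightarrow> 'x pmf"
  assumes horizon_ge_1: "H \<ge> 1"
    and finite_stage: "\<And>h. h \<in> {1..H + 1} \<Longrightarrow> finite (X h)"
    and disjoint_stages: "disjoint_family_on X {1..H + 1}"
    and initial_state: "x1 \<in> X 1"
    and transition: "\<And>h x y. h \<in> {1..H} \<Longrightarrow> x \<in> X h \<Longrightarrow> set_pmf (p x y) \<subseteq> X (h + 1)"

type_synonym ('x, 'y) policy = "'x \<Rightarrow> 'y pmf"

(* (x_h, y_h), ..., (x_H, y_H) together with the final state x_{H+1} *)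
type_synonym ('x, 'y) trajectory = "('x \<times> 'y) list \<times> 'x"

(* The first numeric argument is the number H + 1 - h of actions still to be taken. *)
primrec traj :: "('x \<Rightarrow> 'y \<Rightarrow> 'x pmf) \<Rightarrow> ('x, 'y) policy \<Rightarrow> nat \<Rightarrow> 'x \<Rightarrow> ('x, 'y) trajectory pmf"
  where
    "traj p \<pi> 0 x = return_pmf ([], x)"
  | "traj p \<pi> (Suc n) x =
       bind_pmf (\<pi> x) (\<lambda>y. bind_pmf (p x y) (\<lambda>x'.
         map_pmf (\<lambda>(ss, z). ((x, y) # ss, z)) (traj p \<pi> n x')))"

(* Started at x with the first action y prescribed; n actions remain after the first one. *)
definition traj_sa ::
    "('x \<Rightarrow> 'y \<Rightarrow> 'x pmf) \<Rightarrow> ('x, 'y) policy \<Rightarrow> nat \<Rightarrow> 'x \<Rightarrow> 'y \<Rightarrow> ('x, 'y) trajectory pmf"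
  where
    "traj_sa p \<pi> n x y = bind_pmf (p x y) (\<lambda>x'.
       map_pmf (\<lambda>(ss, z). ((x, y) # ss, z)) (traj p \<pi> n x'))"

(* Only meaningful when set_pmf P is contained in set_pmf Q; then the convention ln 0 = 0
   only affects summands with pmf P y = 0. *)
definition KL_act :: "'y::finite pmf \<Rightarrow> 'y pmf \<Rightarrow> real"
  where "KL_act P Q = (\<Sum>y\<in>UNIV. pmf P y * ln (pmf P y / pmf Q y))"

(* KL(P || Q): the library's KL_divergence takes the reference measure first and is real-valued,
   so the value infinity is supplied when P is not absolutely continuous w.r.t. Q. *)
definition KL_dist :: "'a pmf \<Rightarrow> 'a pmf \<Rightarrow> ereal"
  where "KL_dist P Q =
    (if absolutely_continuous (measure_pmf Q) (measure_pmf P)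
     then ereal (KL_divergence (exp 1) (measure_pmf Q) (measure_pmf P)) else \<infinity>)"

definition KL_traj ::
    "nat \<Rightarrow> 'x \<Rightarrow> ('x \<Rightarrow> 'y \<Rightarrow> 'x pmf) \<Rightarrow> ('x, 'y) policy \<Rightarrow> ('x, 'y) policy \<Rightarrow> ereal"
  where "KL_traj H x1 p \<pi> \<pi>' = KL_dist (traj p \<pi> H x1) (traj p \<pi>' H x1)"

definition admissible ::
    "nat \<Rightarrow> (nat \<Rightarrow> 'x set) \<Rightarrow> ('x, 'y) policy \<Rightarrow> ('x, 'y) policy \<Rightarrow> bool"
  where "admissible H X \<mu> \<pi> \<longleftrightarrow>
    (\<forall>h\<in>{1..H}. \<forall>x\<in>X h. \<forall>y. pmf (\<mu> x) y = 0 \<longrightarrow> pmf (\<pi> x) y = 0)"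

definition reg_return ::
    "('x, 'y::finite) policy \<Rightarrow> real \<Rightarrow> ('x \<Rightarrow> real) \<Rightarrow> ('x, 'y) policy \<Rightarrow> ('x, 'y) trajectory \<Rightarrow> real"
  where "reg_return \<mu> \<alpha> r \<pi> \<tau> =
    r (snd \<tau>) - \<alpha> * (\<Sum>(x, y)\<leftarrow>fst \<tau>. KL_act (\<pi> x) (\<mu> x))"

definition V_reg ::
    "nat \<Rightarrow> ('x \<Rightarrow> 'y::finite \<Rightarrow> 'x pmf) \<Rightarrow> ('x, 'y) policy \<Rightarrow> real \<Rightarrow> ('x \<Rightarrow> real) \<Rightarrow> ('x, 'y) policy
      \<Rightarrow> nat \<Rightarrow> 'x \<Rightarrow> real"
  where "V_reg H p \<mu> \<alpha> r \<pi> h x =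
    measure_pmf.expectation (traj p \<pi> (H + 1 - h) x) (reg_return \<mu> \<alpha> r \<pi>)"

(* As in the definition of V_reg, the penalty at x itself is included. *)
definition Q_reg ::
    "nat \<Rightarrow> ('x \<Rightarrow> 'y::finite \<Rightarrow> 'x pmf) \<Rightarrow> ('x, 'y) policy \<Rightarrow> real \<Rightarrow> ('x \<Rightarrow> real) \<Rightarrow> ('x, 'y) policy
      \<Rightarrow> nat \<Rightarrow> 'x \<Rightarrow> 'y \<Rightarrow> real"
  where "Q_reg H p \<mu> \<alpha> r \<pi> h x y =
    measure_pmf.expectation (traj_sa p \<pi> (H - h) x y) (reg_return \<mu> \<alpha> r \<pi>)"

definition optimal_policy ::
    "nat \<Rightarrow> (nat \<Rightarrow> 'x set) \<Rightarrow> ('x \<Rightarrow> 'y::finite \<Rightarrow> 'x pmf) \<Rightarrow> ('x, 'y) policy \<Rightarrow> real \<Rightarrow> ('x \<Rightarrow> real)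
      \<Rightarrow> ('x, 'y) policy \<Rightarrow> bool"
  where "optimal_policy H X p \<mu> \<alpha> r \<pi>s \<longleftrightarrow>
    (\<forall>h\<in>{1..H + 1}. \<forall>x\<in>X h.
       is_arg_max (\<lambda>\<pi>. V_reg H p \<mu> \<alpha> r \<pi> h x) (admissible H X \<mu>) \<pi>s)"

definition update_objective ::
    "real \<Rightarrow> real \<Rightarrow> 'y::finite pmf \<Rightarrow> 'y pmf \<Rightarrow> ('y \<Rightarrow> real) \<Rightarrow> 'y pmf \<Rightarrow> real"
  where "update_objective \<alpha> \<eta> m c Q q =
    \<eta> * (\<Sum>y\<in>UNIV. pmf q y * Q y) - \<alpha> * \<eta> * KL_act q m - (1 - \<alpha> * \<eta>) * KL_act q c"

(* Besides q << mu x, the candidates q satisfy q << pi t x: for any other q the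
   divergence KL(q || pi t x) is infinite and the objective is minus infinity
   (for learning rates with alpha * eta t < 1), which the real-valued KL_act cannot express. *)
definition rlhf_iterates ::
    "nat \<Rightarrow> (nat \<Rightarrow> 'x set) \<Rightarrow> ('x \<Rightarrow> 'y::finite \<Rightarrow> 'x pmf) \<Rightarrow> ('x, 'y) policy \<Rightarrow> real \<Rightarrow> ('x \<Rightarrow> real)
      \<Rightarrow> (nat \<Rightarrow> real) \<Rightarrow> (nat \<Rightarrow> ('x, 'y) policy) \<Rightarrow> bool"
  where "rlhf_iterates H X p \<mu> \<alpha> r \<eta> \<pi> \<longleftrightarrow>
    (\<forall>h\<in>{1..H}. \<forall>x\<in>X h.
       \<pi> 1 x = \<mu> x \<and>
       (\<forall>t\<ge>1. is_arg_max
          (update_objective \<alpha> (\<eta> t) (\<mu> x) (\<pi> t x) (Q_reg H p \<mu> \<alpha> r (\<pi> t) h x))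
          (\<lambda>q. set_pmf q \<subseteq> set_pmf (\<mu> x) \<and> set_pmf q \<subseteq> set_pmf (\<pi> t x))
          (\<pi> (t + 1) x)))"

end

theory Submission
  imports Defs
begin

text \<open>
  The update is an exponential tilt: \<open>\<pi> (t + 1) x\<close> is proportional to \<open>\<pi> t x y * exp (\<eta> * A y)\<close> with
  \<open>A y = Q y - \<alpha> * ln (\<pi> t x y / \<mu> x y)\<close>. Up to a constant \<open>A\<close> is bounded by \<open>2 * B\<close>, so Hoeffding's lemma
  controls the partition function and yields, at every state, a mirror descent inequality for
  the divergence from the optimal policy whose linear term is a regularized advantage. Summed along
  trajectories of the optimal policy, the divergences add up to the trajectory divergence and the
  advantages to a difference of values, which is nonnegative by optimality. This leaves the scalar
  recursion \<open>K (t + 1) \<le> t / (t + 2) * K t + 8 * D / (t + 2)\<^sup>2\<close> with \<open>D = H * B\<^sup>2 / \<alpha>\<^sup>2\<close>. Its initial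
  value is bounded by the same inequality with the fictitious learning rate \<open>2 / \<alpha>\<close>, for which the
  coefficient of the old divergence is \<open>- 1\<close>.
\<close>

subsection \<open>Tilted distributions on a finite action set\<close>

lemma sum_pmf_UNIV: "(\<Sum>y\<in>UNIV. pmf q y) = 1" for q :: "'y::finite pmf"
  by (rule sum_pmf_eq_1) auto

section \<open>Divergence between action distributions\<close>

lemma KL_act_refl [simp]: "KL_act q q = 0"
  unfolding KL_act_def by (rule sum.neutral) (auto simp: divide_self_if)

text \<open>Rests on \<open>ln u \<le> u - 1\<close> at \<open>u = pmf Q y / pmf P y\<close>. The
  two extra terms cancel in the total but make every single summand nonnegative, so a vanishing
  divergence can be exploited pointwise.\<close>

lemma KL_act_summand_nonneg:
  assumes "set_pmf P \<subseteq> set_pmf Q"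
  shows "pmf P y * ln (pmf P y / pmf Q y) - pmf P y + pmf Q y \<ge> 0"
proof (cases "y \<in> set_pmf P")
  case True
  then have pos: "pmf P y > 0" "pmf Q y > 0"
    using assms by (auto simp: pmf_positive_iff)
  have "ln (pmf Q y / pmf P y) \<le> pmf Q y / pmf P y - 1"
    using pos by (intro ln_le_minus_one) simp
  then have "pmf P y * ln (pmf Q y / pmf P y) \<le> pmf P y * (pmf Q y / pmf P y - 1)"
    using pos by (intro mult_left_mono) auto
  then show ?thesis
    using pos by (simp add: ln_div algebra_simps)
next
  case False
  then show ?thesis
    by (simp add: set_pmf_iff)
qed

lemma KL_act_eq_sum:
  "KL_act P Q = (\<Sum>y\<in>UNIV. pmf P y * ln (pmf P y / pmf Q y) - pmf P y + pmf Q y)"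
  by (simp add: KL_act_def sum.distrib sum_subtractf sum_pmf_UNIV)

lemma KL_act_nonneg: "set_pmf P \<subseteq> set_pmf Q \<Longrightarrow> KL_act P Q \<ge> 0"
  unfolding KL_act_eq_sum by (intro sum_nonneg KL_act_summand_nonneg)

text \<open>Equality in \<open>ln u \<le> u - 1\<close> forces \<open>u = 1\<close>. This is what
  pins down the maximizer of the policy update.\<close>

lemma KL_act_le_0_imp_eq:
  assumes sub: "set_pmf P \<subseteq> set_pmf Q" and "KL_act P Q \<le> 0"
  shows "P = Q"
proof (rule pmf_eqI)
  fix y
  have "KL_act P Q = 0"
    using assms KL_act_nonneg[OF sub] by simp
  then have *: "pmf P y * ln (pmf P y / pmf Q y) - pmf P y + pmf Q y = 0"
    unfolding KL_act_eq_sum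
    by (subst (asm) sum_nonneg_eq_0_iff) (auto intro: KL_act_summand_nonneg[OF sub])
  show "pmf P y = pmf Q y"
  proof (cases "y \<in> set_pmf P")
    case True
    then have pos: "pmf P y > 0" "pmf Q y > 0"
      using assms by (auto simp: pmf_positive_iff)
    have "ln (pmf Q y / pmf P y) = pmf Q y / pmf P y - 1"
      using pos * by (simp add: ln_div field_simps)
    then have "pmf Q y / pmf P y = 1"
      using pos by (intro ln_eq_minus_one) auto
    then show ?thesis
      using pos by simp
  next
    case False
    then show ?thesis
      using * by (simp add: set_pmf_iff)
  qed
qed

lemma KL_act_change_reference:
  assumes "set_pmf P \<subseteq> set_pmf Q" "set_pmf P \<subseteq> set_pmf R"
  shows "KL_act P Q = KL_act P R + (\<Sum>y\<in>UNIV. pmf P y * ln (pmf R y / pmf Q y))"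
  unfolding KL_act_def sum.distrib[symmetric]
proof (intro sum.cong refl)
  fix y
  show "pmf P y * ln (pmf P y / pmf Q y)
      = pmf P y * ln (pmf P y / pmf R y) + pmf P y * ln (pmf R y / pmf Q y)"
  proof (cases "y \<in> set_pmf P")
    case True
    then have "pmf P y > 0" "pmf Q y > 0" "pmf R y > 0"
      using assms by (auto simp: pmf_positive_iff)
    then show ?thesis
      by (simp add: ln_div algebra_simps)
  qed (simp add: set_pmf_iff)
qed

section \<open>Gibbs distributions and the variational form of the update\<close>

definition partition_fun :: "'y::finite pmf \<Rightarrow> ('y \<Rightarrow> real) \<Rightarrow> real"
  where "partition_fun q f = (\<Sum>y\<in>UNIV. pmf q y * exp (f y))"

definition tilt :: "'y::finite pmf \<Rightarrow> ('y \<Rightarrow> real) \<Rightarrow> 'y pmf"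
  where "tilt q f = embed_pmf (\<lambda>y. pmf q y * exp (f y) / partition_fun q f)"

lemma partition_fun_pos: "partition_fun q f > 0"
proof -
  obtain y where "y \<in> set_pmf q"
    using set_pmf_not_empty[of q] by blast
  then show ?thesis
    unfolding partition_fun_def
    by (intro sum_pos2[of _ y]) (auto simp: pmf_positive_iff)
qed

lemma pmf_tilt: "pmf (tilt q f) y = pmf q y * exp (f y) / partition_fun q f"
  unfolding tilt_def
proof (rule pmf_embed_pmf)
  show nonneg: "0 \<le> pmf q y * exp (f y) / partition_fun q f" for y
    using partition_fun_pos[of q f] by simp
  have "(\<Sum>y\<in>UNIV. pmf q y * exp (f y) / partition_fun q f) = 1"
    using partition_fun_pos[of q f]
    by (simp add: sum_divide_distrib[symmetric] partition_fun_def[symmetric])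
  then show "(\<integral>\<^sup>+ y. ennreal (pmf q y * exp (f y) / partition_fun q f) \<partial>count_space UNIV) = 1"
    by (simp add: nn_integral_count_space_finite sum_ennreal nonneg del: times_divide_eq_right)
qed

lemma set_pmf_tilt [simp]: "set_pmf (tilt q f) = set_pmf q"
  using partition_fun_pos[of q f] by (auto simp: set_pmf_eq pmf_tilt)

lemma ln_tilt_ratio:
  assumes "y \<in> set_pmf q"
  shows "ln (pmf q y / pmf (tilt q f) y) = ln (partition_fun q f) - f y"
  using assms partition_fun_pos[of q f]
  by (simp add: pmf_tilt ln_div ln_mult pmf_positive_iff[symmetric])

text \<open>On the support of \<open>P\<close> the log ratio of \<open>q\<close> to its tilt is
  \<open>ln (partition_fun q f) - f y\<close>; averaging over \<open>P\<close> leaves the normalizer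
  as a constant.\<close>

lemma KL_act_tilt:
  assumes "set_pmf P \<subseteq> set_pmf q"
  shows "KL_act P (tilt q f)
    = KL_act P q - (\<Sum>y\<in>UNIV. pmf P y * f y) + ln (partition_fun q f)"
proof -
  have "(\<Sum>y\<in>UNIV. pmf P y * ln (pmf q y / pmf (tilt q f) y))
      = (\<Sum>y\<in>UNIV. pmf P y * (ln (partition_fun q f) - f y))"
    using assms by (intro sum.cong refl) (auto simp: ln_tilt_ratio set_pmf_iff)
  also have "\<dots> = ln (partition_fun q f) - (\<Sum>y\<in>UNIV. pmf P y * f y)"
    by (simp add: right_diff_distrib sum_subtractf sum_distrib_right[symmetric] sum_pmf_UNIV)
  finally show ?thesis
    using KL_act_change_reference[of P "tilt q f" q] assms by simp
qed

text \<open>Gibbs variational principle. Rewritten relative to \<open>c\<close>, the two penalties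
  have total weight \<open>\<alpha> * \<eta> + (1 - \<alpha> * \<eta>) = 1\<close>, and the leftover
  log ratio joins \<open>Q\<close> in \<open>f\<close>.\<close>

lemma update_objective_eq_KL:
  fixes \<alpha> \<eta> :: real and m c q :: "'y::finite pmf" and Q :: "'y \<Rightarrow> real"
  assumes "set_pmf c = set_pmf m" "set_pmf q \<subseteq> set_pmf m"
  defines "f \<equiv> \<lambda>y. \<eta> * (Q y - \<alpha> * ln (pmf c y / pmf m y))"
  shows "update_objective \<alpha> \<eta> m c Q q = ln (partition_fun c f) - KL_act q (tilt c f)"
proof -
  have "(\<Sum>y\<in>UNIV. pmf q y * f y) = \<eta> * (\<Sum>y\<in>UNIV. pmf q y * Q y)
      - \<alpha> * \<eta> * (\<Sum>y\<in>UNIV. pmf q y * ln (pmf c y / pmf m y))"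
    unfolding f_def by (simp add: sum_distrib_left algebra_simps sum_subtractf)
  then show ?thesis
    using KL_act_change_reference[of q m c] KL_act_tilt[of q c f] assms
    unfolding update_objective_def by (simp add: algebra_simps)
qed

text \<open>The tilt is itself a candidate and makes the subtracted divergence zero, so a maximizer
  has divergence at most zero from it.\<close>

lemma is_arg_max_update_objective:
  assumes "set_pmf c = set_pmf m"
    and max: "is_arg_max (update_objective \<alpha> \<eta> m c Q)
      (\<lambda>q. set_pmf q \<subseteq> set_pmf m \<and> set_pmf q \<subseteq> set_pmf c) q"
  shows "q = tilt c (\<lambda>y. \<eta> * (Q y - \<alpha> * ln (pmf c y / pmf m y)))" (is "q = tilt c ?f")
proof -
  have q: "set_pmf q \<subseteq> set_pmf m"
    using max by (simp add: is_arg_max_def)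
  have "\<not> update_objective \<alpha> \<eta> m c Q q < update_objective \<alpha> \<eta> m c Q (tilt c ?f)"
    using max assms(1) unfolding is_arg_max_def by (metis set_pmf_tilt order_refl)
  then have "KL_act q (tilt c ?f) \<le> 0"
    using assms(1) q by (simp add: update_objective_eq_KL)
  then show ?thesis
    using assms(1) q by (intro KL_act_le_0_imp_eq) auto
qed

text \<open>Hoeffding's lemma for \<open>X\<close> centred at its mean under \<open>q\<close>;
  undoing the centring produces the linear term.\<close>

lemma ln_partition_fun_le:
  assumes "l > 0" and X: "\<And>y. y \<in> set_pmf q \<Longrightarrow> X y \<in> {a..b}"
  shows "ln (partition_fun q (\<lambda>y. l * X y))
    \<le> l * (\<Sum>y\<in>UNIV. pmf q y * X y) + l\<^sup>2 * (b - a)\<^sup>2 / 8"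
proof -
  interpret interval_bounded_random_variable "measure_pmf q" X a b
    by unfold_locales (use X in \<open>auto simp: AE_measure_pmf_iff\<close>)
  define m where "m = (\<Sum>y\<in>UNIV. pmf q y * X y)"
  have E: "measure_pmf.expectation q g = (\<Sum>y\<in>UNIV. pmf q y * g y)" for g :: "_ \<Rightarrow> real"
    by (subst integral_measure_pmf[of UNIV]) auto
  have "ennreal (\<Sum>y\<in>UNIV. pmf q y * exp (l * (X y - m)))
      = (\<integral>\<^sup>+y. exp (l * (X y - m)) \<partial>measure_pmf q)"
    unfolding E[symmetric]
    by (rule nn_integral_eq_integral[symmetric]) (auto intro: integrable_measure_pmf_finite)
  also have "\<dots> \<le> ennreal (exp (l\<^sup>2 * (b - a)\<^sup>2 / 8))"
    using Hoeffdings_lemma_nn_integral[OF \<open>l > 0\<close>] by (simp add: E m_def)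
  finally have "(\<Sum>y\<in>UNIV. pmf q y * exp (l * (X y - m))) \<le> exp (l\<^sup>2 * (b - a)\<^sup>2 / 8)"
    by simp
  moreover have "(\<Sum>y\<in>UNIV. pmf q y * exp (l * (X y - m)))
      = partition_fun q (\<lambda>y. l * X y) / exp (l * m)"
    by (simp add: partition_fun_def right_diff_distrib exp_diff sum_divide_distrib)
  ultimately have "partition_fun q (\<lambda>y. l * X y) \<le> exp (l * m + l\<^sup>2 * (b - a)\<^sup>2 / 8)"
    by (simp only: exp_add) (simp add: pos_divide_le_eq mult.commute)
  then have "ln (partition_fun q (\<lambda>y. l * X y)) \<le> ln (exp (l * m + l\<^sup>2 * (b - a)\<^sup>2 / 8))"
    using partition_fun_pos by (subst ln_le_cancel_iff) auto
  then show ?thesis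
    by (simp add: m_def)
qed

text \<open>Changing the reference from \<open>m\<close> to \<open>c\<close> in the linear term
  produces \<open>\<alpha> * \<eta> * KL_act P c\<close>, which lowers the coefficient of the old
  divergence to \<open>1 - \<alpha> * \<eta>\<close>. This coefficient may be negative, as the bound
  on the initial divergence requires.\<close>

lemma mirror_step:
  assumes supp: "set_pmf c = set_pmf m" "set_pmf P \<subseteq> set_pmf m" and "\<eta> > 0"
    and Q: "\<And>y. \<bar>Q y\<bar> \<le> B"
    and k: "\<And>y. y \<in> set_pmf m \<Longrightarrow> \<bar>\<alpha> * ln (pmf c y / pmf m y) - k\<bar> \<le> B"
  shows "KL_act P (tilt c (\<lambda>y. \<eta> * (Q y - \<alpha> * ln (pmf c y / pmf m y))))
    \<le> (1 - \<alpha> * \<eta>) * KL_act P c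
      - \<eta> * ((\<Sum>y\<in>UNIV. pmf P y * Q y) - \<alpha> * KL_act P m
             - ((\<Sum>y\<in>UNIV. pmf c y * Q y) - \<alpha> * KL_act c m))
      + 2 * \<eta>\<^sup>2 * B\<^sup>2"
proof -
  define A where "A y = Q y - \<alpha> * ln (pmf c y / pmf m y)" for y
  \<comment> \<open>One \<open>B\<close> comes from \<open>Q\<close>, the other from the deviation
    of the log ratio from \<open>k\<close>. The interval has length \<open>4 * B\<close>, and
    \<open>(4 * B)\<^sup>2 / 8 = 2 * B\<^sup>2\<close>.\<close>
  have A: "A y \<in> {- k - 2 * B..- k + 2 * B}" if "y \<in> set_pmf c" for y
    using Q[of y] k[of y] that supp unfolding A_def by (auto simp: abs_le_iff)
  have dot: "(\<Sum>y\<in>UNIV. pmf P' y * A y)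
      = (\<Sum>y\<in>UNIV. pmf P' y * Q y) - \<alpha> * (KL_act P' m - KL_act P' c)"
    if "set_pmf P' \<subseteq> set_pmf m" for P'
    using KL_act_change_reference[of P' m c] that supp unfolding A_def
    by (simp add: sum_distrib_left algebra_simps sum_subtractf)
  have "KL_act P (tilt c (\<lambda>y. \<eta> * A y))
      = KL_act P c - \<eta> * (\<Sum>y\<in>UNIV. pmf P y * A y) + ln (partition_fun c (\<lambda>y. \<eta> * A y))"
    using supp by (subst KL_act_tilt) (auto simp: sum_distrib_left algebra_simps)
  moreover have "ln (partition_fun c (\<lambda>y. \<eta> * A y))
      \<le> \<eta> * (\<Sum>y\<in>UNIV. pmf c y * A y) + 2 * \<eta>\<^sup>2 * B\<^sup>2"
    using ln_partition_fun_le[OF \<open>\<eta> > 0\<close>, of c A, OF A] by (simp add: power2_eq_square mult_ac)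
  ultimately show ?thesis
    unfolding A_def[symmetric] dot[OF supp(2)] dot[OF eq_refl[OF supp(1)]]
    by (simp add: algebra_simps)
qed

text \<open>Measured from the new centre, the scaled log ratio is the convex combination of the old
  deviation and \<open>Q y\<close> with weights \<open>1 - \<alpha> * \<eta>\<close> and
  \<open>\<alpha> * \<eta>\<close>. Hence the bound \<open>B\<close> does not grow with the
  iterations.\<close>

lemma log_ratio_tilt:
  fixes \<alpha> \<eta> k B :: real and m c :: "'y::finite pmf" and Q :: "'y \<Rightarrow> real"
  assumes supp: "set_pmf c = set_pmf m" and \<eta>: "0 \<le> \<alpha> * \<eta>" "\<alpha> * \<eta> \<le> 1"
    and Q: "\<And>y. \<bar>Q y\<bar> \<le> B"
    and k: "\<And>y. y \<in> set_pmf m \<Longrightarrow> \<bar>\<alpha> * ln (pmf c y / pmf m y) - k\<bar> \<le> B"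
  defines "f \<equiv> \<lambda>y. \<eta> * (Q y - \<alpha> * ln (pmf c y / pmf m y))"
  assumes y: "y \<in> set_pmf m"
  shows "\<bar>\<alpha> * ln (pmf (tilt c f) y / pmf m y)
    - ((1 - \<alpha> * \<eta>) * k - \<alpha> * ln (partition_fun c f))\<bar> \<le> B"
proof -
  define L where "L = ln (pmf c y / pmf m y)"
  have "pmf c y > 0" "pmf m y > 0" "pmf (tilt c f) y > 0"
    using y supp by (simp_all add: pmf_positive_iff)
  then have "ln (pmf (tilt c f) y / pmf m y) = L - ln (pmf c y / pmf (tilt c f) y)"
    by (simp add: L_def ln_div)
  also have "\<dots> = L - ln (partition_fun c f) + \<eta> * (Q y - \<alpha> * L)"
    using y supp by (simp add: ln_tilt_ratio f_def L_def)
  finally have ratio: "ln (pmf (tilt c f) y / pmf m y)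
      = L - ln (partition_fun c f) + \<eta> * (Q y - \<alpha> * L)" .
  have "\<alpha> * ln (pmf (tilt c f) y / pmf m y)
      - ((1 - \<alpha> * \<eta>) * k - \<alpha> * ln (partition_fun c f))
    = (1 - \<alpha> * \<eta>) * (\<alpha> * L - k) + (\<alpha> * \<eta>) * Q y"
    unfolding ratio by (simp add: algebra_simps)
  also have "\<bar>\<dots>\<bar> \<le> (1 - \<alpha> * \<eta>) * \<bar>\<alpha> * L - k\<bar> + (\<alpha> * \<eta>) * \<bar>Q y\<bar>"
    using \<eta> by (intro order.trans[OF abs_triangle_ineq])
      (simp add: abs_mult[of "1 - \<alpha> * \<eta>"] abs_mult[of "\<alpha> * \<eta>"])
  also have "\<dots> \<le> (1 - \<alpha> * \<eta>) * B + (\<alpha> * \<eta>) * B"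
    using \<eta> Q[of y] k[OF y] by (intro add_mono mult_left_mono) (auto simp: L_def)
  finally show ?thesis
    by (simp add: algebra_simps)
qed

subsection \<open>Trajectories\<close>

lemma expectation_bind_pmf_finite:
  fixes h :: "'b \<Rightarrow> real"
  assumes "finite (set_pmf q)" "\<And>x. x \<in> set_pmf q \<Longrightarrow> finite (set_pmf (f x))"
  shows "measure_pmf.expectation (bind_pmf q f) h
    = measure_pmf.expectation q (\<lambda>x. measure_pmf.expectation (f x) h)"
  using assms by (simp add: pmf_expectation_bind[of "set_pmf q"] integral_measure_pmf[of "set_pmf q"])

lemma expectation_finite_type:
  "measure_pmf.expectation q f = (\<Sum>y\<in>UNIV. pmf q y * f y)" for f :: "'y::finite \<Rightarrow> real"
  by (subst integral_measure_pmf[of UNIV]) auto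

text \<open>By the support inclusion the pointwise ratio \<open>f\<close> is a density of
  \<open>P\<close> with respect to \<open>Q\<close>, and integrating \<open>f * ln f\<close> against
  \<open>Q\<close> is integrating \<open>ln f\<close> against \<open>P\<close>.\<close>

lemma KL_dist_eq_expectation:
  assumes "set_pmf P \<subseteq> set_pmf Q"
  shows "KL_dist P Q = ereal (measure_pmf.expectation P (\<lambda>x. ln (pmf P x / pmf Q x)))"
proof -
  define f where "f x = pmf P x / pmf Q x" for x
  have "ennreal (pmf Q x) * ennreal (f x) = ennreal (pmf P x)" for x
    using assms by (cases "x \<in> set_pmf Q")
      (auto simp: f_def ennreal_mult'[symmetric] set_pmf_iff)
  then have P: "measure_pmf P = density (measure_pmf Q) f"
    by (simp add: measure_pmf_eq_density density_density_eq)
  have "KL_divergence (exp 1) (measure_pmf Q) (measure_pmf P)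
      = (\<integral>x. f x * log (exp 1) (f x) \<partial>measure_pmf Q)"
    unfolding P
    by (rule sigma_finite_measure.KL_density[OF measure_pmf.sigma_finite_measure_axioms])
      (auto simp: f_def)
  also have "\<dots> = (\<integral>x. ln (f x) \<partial>measure_pmf P)"
    unfolding P by (subst integral_real_density) (auto simp: f_def log_def)
  moreover have "absolutely_continuous (measure_pmf Q) (measure_pmf P)"
    unfolding P by (rule absolutely_continuousI_density) simp
  ultimately show ?thesis
    by (simp add: KL_dist_def f_def)
qed

section \<open>Likelihood ratios of trajectories\<close>

lemma traj_Suc_eq: "traj p \<pi> (Suc n) x = bind_pmf (\<pi> x) (traj_sa p \<pi> n x)"
  by (simp add: traj_sa_def[abs_def])

lemma traj_sa_eq_map:
  "traj_sa p \<pi> n x y = map_pmf (\<lambda>(ss, z). ((x, y) # ss, z)) (bind_pmf (p x y) (traj p \<pi> n))"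
  by (simp add: traj_sa_def map_bind_pmf)

lemma pmf_traj_sa:
  "pmf (traj_sa p \<pi> n x y) (s # ss, z)
    = (if s = (x, y) then measure_pmf.expectation (p x y) (\<lambda>x'. pmf (traj p \<pi> n x') (ss, z)) else 0)"
proof (cases "s = (x, y)")
  case True
  have "pmf (traj_sa p \<pi> n x y) ((\<lambda>(ss, z). ((x, y) # ss, z)) (ss, z))
      = pmf (bind_pmf (p x y) (traj p \<pi> n)) (ss, z)"
    unfolding traj_sa_eq_map by (rule pmf_map_inj') (auto simp: inj_def)
  then show ?thesis
    using True by (simp add: pmf_bind)
next
  case False
  then have "(s # ss, z) \<notin> set_pmf (traj_sa p \<pi> n x y)"
    by (auto simp: traj_sa_def)
  then show ?thesis
    using False by (simp add: set_pmf_iff)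
qed

lemma pmf_traj_Suc:
  "pmf (traj p \<pi> (Suc n) x) ((x0, y) # ss, z)
    = (if x0 = x then pmf (\<pi> x) y
         * measure_pmf.expectation (p x y) (\<lambda>x'. pmf (traj p \<pi> n x') (ss, z)) else 0)"
  unfolding traj_Suc_eq pmf_bind pmf_traj_sa
  by (subst integral_measure_pmf_real[of "{y}"]) (auto split: if_splits)

definition action_likelihood :: "('x, 'y) policy \<Rightarrow> ('x \<times> 'y) list \<Rightarrow> real"
  where "action_likelihood \<pi> ss = (\<Prod>(x, y)\<leftarrow>ss. pmf (\<pi> x) y)"

text \<open>The ratio of two trajectory probabilities is free of the transition probabilities; the
  cross-multiplied form needs no assumption on supports.\<close>
lemma pmf_traj_cross:
  "pmf (traj p \<pi> n x) (ss, z) * action_likelihood \<pi>' ss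
    = pmf (traj p \<pi>' n x) (ss, z) * action_likelihood \<pi> ss"
proof (induction n arbitrary: x ss)
  case 0
  show ?case
    by (cases ss) (simp_all add: action_likelihood_def)
next
  case (Suc n)
  show ?case
  proof (cases ss)
    case Nil
    have "([], z) \<notin> set_pmf (traj p \<pi>'' (Suc n) x)" for \<pi>''
      by auto
    then show ?thesis
      using Nil by (simp add: set_pmf_iff del: traj.simps)
  next
    case (Cons s ss')
    obtain x0 y where s: "s = (x0, y)"
      by fastforce
    \<comment> \<open>Constants move through the integral unconditionally, so the induction
      hypothesis applies under it without any finiteness of supports.\<close>
    have "measure_pmf.expectation (p x y) (\<lambda>x'. pmf (traj p \<pi> n x') (ss', z))
          * action_likelihood \<pi>' ss'
        = measure_pmf.expectation (p x y) (\<lambda>x'. pmf (traj p \<pi>' n x') (ss', z))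
          * action_likelihood \<pi> ss'"
      unfolding integral_mult_left_zero[symmetric] Suc.IH ..
    then show ?thesis
      unfolding Cons s pmf_traj_Suc by (simp add: action_likelihood_def algebra_simps)
  qed
qed

lemma action_likelihood_pos:
  assumes "\<And>x y. (x, y) \<in> set ss \<Longrightarrow> y \<in> set_pmf (\<pi> x)"
  shows "action_likelihood \<pi> ss > 0"
  using assms by (induction ss) (auto simp: action_likelihood_def pmf_positive_iff)

lemma ln_action_likelihood_ratio:
  assumes "\<And>x y. (x, y) \<in> set ss \<Longrightarrow> y \<in> set_pmf (\<pi> x)"
    and "\<And>x y. (x, y) \<in> set ss \<Longrightarrow> y \<in> set_pmf (\<pi>' x)"
  shows "ln (action_likelihood \<pi> ss / action_likelihood \<pi>' ss)
    = (\<Sum>(x, y)\<leftarrow>ss. ln (pmf (\<pi> x) y / pmf (\<pi>' x) y))"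
  using assms
proof (induction ss)
  case Nil
  then show ?case
    by (simp add: action_likelihood_def)
next
  case (Cons s ss)
  obtain x y where s: "s = (x, y)"
    by fastforce
  have "action_likelihood \<pi> ss > 0" "action_likelihood \<pi>' ss > 0"
    using Cons.prems by (auto intro!: action_likelihood_pos)
  moreover have "pmf (\<pi> x) y > 0" "pmf (\<pi>' x) y > 0"
    using Cons.prems by (auto simp: s pmf_positive_iff)
  moreover have "action_likelihood \<pi>'' (s # ss) = pmf (\<pi>'' x) y * action_likelihood \<pi>'' ss" for \<pi>''
    by (simp add: action_likelihood_def s)
  ultimately show ?case
    using Cons by (simp add: s ln_div ln_mult)
qed

text \<open>The arguments \<open>n\<close> (stages to sum) and \<open>h\<close> (current stage) are used with \<open>h + n = H + 1\<close>.\<close>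
primrec expected_sum ::
    "('x \<Rightarrow> 'y::finite \<Rightarrow> 'x pmf) \<Rightarrow> ('x, 'y) policy \<Rightarrow> (nat \<Rightarrow> 'x \<Rightarrow> real) \<Rightarrow> nat \<Rightarrow> nat \<Rightarrow> 'x \<Rightarrow> real"
  where
    "expected_sum p \<pi> g 0 h x = 0"
  | "expected_sum p \<pi> g (Suc n) h x = g h x + (\<Sum>y\<in>UNIV. pmf (\<pi> x) y
       * measure_pmf.expectation (p x y) (expected_sum p \<pi> g n (Suc h)))"

text \<open>The gain from one stage of \<open>\<pi>'\<close> followed by \<open>\<pi>\<close>.
  \<open>Q_reg\<close> already contains the penalty of \<open>\<pi>\<close> at \<open>x\<close>, but
  this is the same for all actions and cancels between the two sums.\<close>

definition advantage ::
    "nat \<Rightarrow> ('x \<Rightarrow> 'y::finite \<Rightarrow> 'x pmf) \<Rightarrow> ('x, 'y) policy \<Rightarrow> real \<Rightarrow> ('x \<Rightarrow> real)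
      \<Rightarrow> ('x, 'y) policy \<Rightarrow> ('x, 'y) policy \<Rightarrow> nat \<Rightarrow> 'x \<Rightarrow> real"
  where "advantage H p \<mu> \<alpha> r \<pi>' \<pi> h x =
    (\<Sum>y\<in>UNIV. pmf (\<pi>' x) y * Q_reg H p \<mu> \<alpha> r \<pi> h x y) - \<alpha> * KL_act (\<pi>' x) (\<mu> x)
    - ((\<Sum>y\<in>UNIV. pmf (\<pi> x) y * Q_reg H p \<mu> \<alpha> r \<pi> h x y) - \<alpha> * KL_act (\<pi> x) (\<mu> x))"

section \<open>Backward induction over the stages\<close>

context finite_horizon_mdp
begin

lemma next_stage:
  "h \<in> {1..H} \<Longrightarrow> x \<in> X h \<Longrightarrow> x' \<in> set_pmf (p x y) \<Longrightarrow> x' \<in> X (Suc h)"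
  using transition[of h x y] by auto

lemma finite_set_transition: "h \<in> {1..H} \<Longrightarrow> x \<in> X h \<Longrightarrow> finite (set_pmf (p x y))"
  using transition[of h x y] finite_stage[of "h + 1"] by (auto intro: finite_subset)

text \<open>Transitions lead from one stage to the next, so the hypothesis is available at every
  possible successor while \<open>h + n\<close> stays fixed.\<close>

lemma stage_induct [consumes 3, case_names terminal step]:
  assumes "h \<ge> 1" "h + n = H + 1" "x \<in> X h"
    and "\<And>x. x \<in> X (H + 1) \<Longrightarrow> P 0 (H + 1) x"
    and "\<And>n h x. \<lbrakk>h \<in> {1..H}; h + Suc n = H + 1; x \<in> X h;
           \<And>x' y. x' \<in> set_pmf (p x y) \<Longrightarrow> P n (Suc h) x'\<rbrakk> \<Longrightarrow> P (Suc n) h x"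
  shows "P n h x"
  using assms(1-3)
proof (induction n arbitrary: h x)
  case 0
  then show ?case
    using assms(4) by simp
next
  case (Suc n)
  then show ?case
    using next_stage[of h x] by (intro assms(5)) auto
qed

text \<open>The state type may be infinite; this finiteness is what makes every function of a
  trajectory integrable.\<close>

lemma finite_set_traj:
  assumes "h \<ge> 1" "h + n = H + 1" "x \<in> X h"
  shows "finite (set_pmf (traj p \<pi> n x))"
  using assms
proof (induction rule: stage_induct)
  case (step n h x)
  then have "finite (set_pmf (p x y))" for y
    by (intro finite_set_transition) auto
  then show ?case
    using step by auto
qed simp

text \<open>Supports of policies are compared only at states of the stages, so trajectories have to
  be confined to those states.\<close>

lemma set_traj_stage:
  assumes "h \<ge> 1" "h + n = H + 1" "x \<in> X h"
  shows "\<forall>(ss, z) \<in> set_pmf (traj p \<pi> n x). \<forall>(x', y) \<in> set ss.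
    y \<in> set_pmf (\<pi> x') \<and> (\<exists>h'\<in>{1..H}. x' \<in> X h')"
  using assms
proof (induction rule: stage_induct)
  case (step n h x)
  then show ?case
    by (fastforce simp del: atLeastAtMost_iff)
qed auto

lemma expectation_traj_sa:
  fixes f :: "('x, 'y) trajectory \<Rightarrow> real"
  assumes "h \<in> {1..H}" "h + Suc n = H + 1" "x \<in> X h"
  shows "measure_pmf.expectation (traj_sa p \<pi> n x y) f
    = measure_pmf.expectation (p x y) (\<lambda>x'.
        measure_pmf.expectation (traj p \<pi> n x') (\<lambda>(ss, z). f ((x, y) # ss, z)))"
proof -
  have "finite (set_pmf (traj p \<pi> n x'))" if "x' \<in> set_pmf (p x y)" for x'
    using that assms next_stage by (intro finite_set_traj[of "Suc h"]) auto
  then show ?thesis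
    using finite_set_transition[OF assms(1,3)] unfolding traj_sa_def
    by (subst expectation_bind_pmf_finite) (auto simp: case_prod_unfold)
qed

lemma expectation_traj_Suc:
  fixes f :: "('x, 'y) trajectory \<Rightarrow> real"
  assumes "h \<in> {1..H}" "h + Suc n = H + 1" "x \<in> X h"
  shows "measure_pmf.expectation (traj p \<pi> (Suc n) x) f
    = (\<Sum>y\<in>UNIV. pmf (\<pi> x) y * measure_pmf.expectation (traj_sa p \<pi> n x y) f)"
proof -
  have "finite (set_pmf (traj p \<pi> n x'))" if "x' \<in> set_pmf (p x y)" for x' y
    using that assms next_stage by (intro finite_set_traj[of "Suc h"]) auto
  then show ?thesis
    using finite_set_transition[OF assms(1,3)] unfolding traj_Suc_eq
    by (subst expectation_bind_pmf_finite) (auto simp: expectation_finite_type traj_sa_def)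
qed

lemma V_reg_eq_Q_reg:
  assumes "h \<in> {1..H}" "x \<in> X h"
  shows "V_reg H p \<mu> \<alpha> r \<pi> h x = (\<Sum>y\<in>UNIV. pmf (\<pi> x) y * Q_reg H p \<mu> \<alpha> r \<pi> h x y)"
proof -
  have "H + 1 - h = Suc (H - h)"
    using assms by auto
  then show ?thesis
    unfolding V_reg_def Q_reg_def using assms
    by (simp only:) (rule expectation_traj_Suc[of h]; simp)
qed

text \<open>Bellman equation: the penalty at \<open>x\<close> is common to all continuations and
  leaves the expectation.\<close>

lemma Q_reg_eq_V_reg:
  assumes "h \<in> {1..H}" "x \<in> X h"
  shows "Q_reg H p \<mu> \<alpha> r \<pi> h x y
    = measure_pmf.expectation (p x y) (V_reg H p \<mu> \<alpha> r \<pi> (Suc h)) - \<alpha> * KL_act (\<pi> x) (\<mu> x)"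
proof -
  have int: "integrable (measure_pmf (traj p \<pi> (H - h) x')) f"
    if "x' \<in> set_pmf (p x y)" for x' and f :: "('x, 'y) trajectory \<Rightarrow> real"
    using that assms next_stage
    by (intro integrable_measure_pmf_finite finite_set_traj[of "Suc h"]) auto
  have "Q_reg H p \<mu> \<alpha> r \<pi> h x y = measure_pmf.expectation (p x y) (\<lambda>x'.
      measure_pmf.expectation (traj p \<pi> (H - h) x')
        (\<lambda>\<tau>. reg_return \<mu> \<alpha> r \<pi> \<tau> - \<alpha> * KL_act (\<pi> x) (\<mu> x)))"
    unfolding Q_reg_def using assms
    by (subst expectation_traj_sa[of h])
      (auto simp: reg_return_def case_prod_unfold algebra_simps)
  also have "\<dots> = measure_pmf.expectation (p x y)
      (\<lambda>x'. V_reg H p \<mu> \<alpha> r \<pi> (Suc h) x' - \<alpha> * KL_act (\<pi> x) (\<mu> x))"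
    by (intro integral_cong_AE)
      (auto simp: AE_measure_pmf_iff V_reg_def Bochner_Integration.integral_diff[OF int measure_pmf.integrable_const])
  also have "\<dots> = measure_pmf.expectation (p x y) (V_reg H p \<mu> \<alpha> r \<pi> (Suc h))
      - \<alpha> * KL_act (\<pi> x) (\<mu> x)"
    using assms by (subst Bochner_Integration.integral_diff)
      (auto intro!: integrable_measure_pmf_finite finite_set_transition)
  finally show ?thesis .
qed

section \<open>Sums accumulated along trajectories\<close>

lemma expected_sum_mono:
  assumes "h \<ge> 1" "h + n = H + 1" "x \<in> X h"
    and "\<And>h x. h \<in> {1..H} \<Longrightarrow> x \<in> X h \<Longrightarrow> g h x \<le> g' h x"
  shows "expected_sum p \<pi> g n h x \<le> expected_sum p \<pi> g' n h x"
  using assms(1-3)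
proof (induction rule: stage_induct)
  case (step n h x)
  then show ?case
    unfolding expected_sum.simps
    by (intro add_mono assms(4) sum_mono mult_left_mono integral_mono_AE)
      (auto simp: AE_measure_pmf_iff intro!: integrable_measure_pmf_finite finite_set_transition)
qed simp

text \<open>The constant is collected once per stage because probabilities have total mass one; with
  \<open>n = H\<close> this is the source of the factor \<open>H\<close> in the final bound.\<close>

lemma expected_sum_affine:
  assumes "h \<ge> 1" "h + n = H + 1" "x \<in> X h"
  shows "expected_sum p \<pi> (\<lambda>h x. a * g h x + b * g' h x + c) n h x
    = a * expected_sum p \<pi> g n h x + b * expected_sum p \<pi> g' n h x + c * real n"
  using assms
proof (induction rule: stage_induct)
  case (step n h x)
  have int: "integrable (measure_pmf (p x y)) f" for y and f :: "'x \<Rightarrow> real"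
    using step by (intro integrable_measure_pmf_finite finite_set_transition) auto
  have "measure_pmf.expectation (p x y)
        (expected_sum p \<pi> (\<lambda>h x. a * g h x + b * g' h x + c) n (Suc h))
      = measure_pmf.expectation (p x y) (\<lambda>x'. a * expected_sum p \<pi> g n (Suc h) x'
          + b * expected_sum p \<pi> g' n (Suc h) x' + c * real n)" for y
    using step by (intro integral_cong_AE) (auto simp: AE_measure_pmf_iff)
  also have "\<dots> y = a * measure_pmf.expectation (p x y) (expected_sum p \<pi> g n (Suc h))
      + b * measure_pmf.expectation (p x y) (expected_sum p \<pi> g' n (Suc h)) + c * real n" for y
    by (simp add: int)
  finally show ?case
    by (simp add: algebra_simps sum.distrib sum_distrib_left[symmetric] sum_distrib_right[symmetric]
        sum_pmf_UNIV)
qed simp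

text \<open>Telescoping: the expected \<open>V_reg\<close> of \<open>\<pi>\<close> at the next
  stage, subtracted by the induction hypothesis, cancels against the one inside the advantage. At
  the final stage both values equal the reward.\<close>

lemma performance_difference:
  assumes "h \<ge> 1" "h + n = H + 1" "x \<in> X h"
  shows "expected_sum p \<pi>' (advantage H p \<mu> \<alpha> r \<pi>' \<pi>) n h x
    = V_reg H p \<mu> \<alpha> r \<pi>' h x - V_reg H p \<mu> \<alpha> r \<pi> h x"
  using assms
proof (induction rule: stage_induct)
  case (terminal x)
  then show ?case
    by (simp add: V_reg_def reg_return_def)
next
  case (step n h x)
  let ?V = "\<lambda>\<pi> y. measure_pmf.expectation (p x y) (V_reg H p \<mu> \<alpha> r \<pi> (Suc h))"
  have int: "integrable (measure_pmf (p x y)) f" for y and f :: "'x \<Rightarrow> real"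
    using step by (intro integrable_measure_pmf_finite finite_set_transition) auto
  have "measure_pmf.expectation (p x y)
        (expected_sum p \<pi>' (advantage H p \<mu> \<alpha> r \<pi>' \<pi>) n (Suc h))
      = measure_pmf.expectation (p x y)
          (\<lambda>x'. V_reg H p \<mu> \<alpha> r \<pi>' (Suc h) x' - V_reg H p \<mu> \<alpha> r \<pi> (Suc h) x')" for y
    using step by (intro integral_cong_AE) (auto simp: AE_measure_pmf_iff)
  then have IH: "measure_pmf.expectation (p x y)
      (expected_sum p \<pi>' (advantage H p \<mu> \<alpha> r \<pi>' \<pi>) n (Suc h)) = ?V \<pi>' y - ?V \<pi> y" for y
    by (simp add: int)
  have Q: "(\<Sum>y\<in>UNIV. pmf (\<pi>1 x) y * Q_reg H p \<mu> \<alpha> r \<pi>2 h x y)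
      = (\<Sum>y\<in>UNIV. pmf (\<pi>1 x) y * ?V \<pi>2 y) - \<alpha> * KL_act (\<pi>2 x) (\<mu> x)" for \<pi>1 \<pi>2
    using step by (simp add: Q_reg_eq_V_reg right_diff_distrib sum_subtractf
        sum_distrib_right[symmetric] sum_pmf_UNIV)
  show ?case
    using step(1,3) unfolding expected_sum.simps IH
    by (simp add: advantage_def V_reg_eq_Q_reg Q right_diff_distrib sum_subtractf)
qed

text \<open>Links sums over the recorded state-action pairs to the backward recursion, in which
  inequalities at single states can be accumulated.\<close>

lemma expectation_traj_sum_list:
  assumes "h \<ge> 1" "h + n = H + 1" "x \<in> X h"
  shows "measure_pmf.expectation (traj p \<pi> n x) (\<lambda>(ss, z). \<Sum>(x, y)\<leftarrow>ss. l x y)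
    = expected_sum p \<pi> (\<lambda>h x. \<Sum>y\<in>UNIV. pmf (\<pi> x) y * l x y) n h x"
  using assms
proof (induction rule: stage_induct)
  case (step n h x)
  let ?L = "\<lambda>(ss, z). \<Sum>(x, y)\<leftarrow>ss. l x y"
  have int: "integrable (measure_pmf (traj p \<pi> n x')) f"
    if "x' \<in> set_pmf (p x y)" for x' y and f :: "('x, 'y) trajectory \<Rightarrow> real"
    using that step(1-3) next_stage
    by (intro integrable_measure_pmf_finite finite_set_traj[of "Suc h"]) auto
  have "measure_pmf.expectation (traj_sa p \<pi> n x y) ?L
      = measure_pmf.expectation (p x y) (\<lambda>x'.
          measure_pmf.expectation (traj p \<pi> n x') (\<lambda>\<tau>. l x y + ?L \<tau>))" for y
    using step(1-3) by (subst expectation_traj_sa[of h]) (auto simp: case_prod_unfold)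
  also have "\<dots> y = measure_pmf.expectation (p x y)
      (\<lambda>x'. l x y + expected_sum p \<pi> (\<lambda>h x. \<Sum>y\<in>UNIV. pmf (\<pi> x) y * l x y) n (Suc h) x')" for y
    using step(4)
    by (intro integral_cong_AE)
      (auto simp: AE_measure_pmf_iff Bochner_Integration.integral_add[OF measure_pmf.integrable_const int])
  also have "\<dots> y = l x y + measure_pmf.expectation (p x y)
      (expected_sum p \<pi> (\<lambda>h x. \<Sum>y\<in>UNIV. pmf (\<pi> x) y * l x y) n (Suc h))" for y
    using step(1-3) by (subst Bochner_Integration.integral_add)
      (auto intro!: integrable_measure_pmf_finite finite_set_transition)
  finally show ?case
    using step(1-3) by (subst expectation_traj_Suc[of h]) (auto simp: distrib_left sum.distrib)
qed simp

text \<open>Chain rule for the divergence. The transition factors cancel in the likelihood ratio,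
  and the logarithm turns the remaining product over actions into a sum along the
  trajectory.\<close>

lemma KL_traj_eq_expected_sum:
  assumes supp: "\<And>h x. h \<in> {1..H} \<Longrightarrow> x \<in> X h \<Longrightarrow> set_pmf (\<pi> x) \<subseteq> set_pmf (\<pi>' x)"
  shows "KL_traj H x1 p \<pi> \<pi>'
    = ereal (expected_sum p \<pi> (\<lambda>h x. KL_act (\<pi> x) (\<pi>' x)) H 1 x1)"
proof -
  let ?P = "traj p \<pi> H x1" and ?Q = "traj p \<pi>' H x1"
  \<comment> \<open>These are the premises of \<open>stage_induct\<close> for \<open>h = 1\<close>,
    \<open>n = H\<close> and the initial state.\<close>
  note start = order_refl[of "1::nat"] add.commute[of 1 H] initial_state
  have *: "(ss, z) \<in> set_pmf ?Q \<and> ln (pmf ?P (ss, z) / pmf ?Q (ss, z))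
      = (\<Sum>(x, y)\<leftarrow>ss. ln (pmf (\<pi> x) y / pmf (\<pi>' x) y))"
    if \<tau>: "(ss, z) \<in> set_pmf ?P" for ss z
  proof -
    have ss: "y \<in> set_pmf (\<pi> x)" "y \<in> set_pmf (\<pi>' x)" if "(x, y) \<in> set ss" for x y
      using set_traj_stage[OF start, of \<pi>] \<tau> that supp by fastforce+
    have w: "action_likelihood \<pi> ss > 0" "action_likelihood \<pi>' ss > 0"
      using ss by (auto intro!: action_likelihood_pos)
    have P: "pmf ?P (ss, z) > 0"
      using \<tau> by (simp add: pmf_positive_iff)
    note cross = pmf_traj_cross[of p \<pi> H x1 ss z \<pi>']
    \<comment> \<open>Positivity is extracted from the cross-multiplied identity first: it gives the
      support inclusion and permits the division that follows.\<close>
    then have Q: "pmf ?Q (ss, z) > 0"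
      using P w by (metis mult_pos_pos zero_less_mult_pos2)
    moreover have "pmf ?P (ss, z) / pmf ?Q (ss, z)
        = action_likelihood \<pi> ss / action_likelihood \<pi>' ss"
      using cross w Q by (simp add: field_simps)
    ultimately show ?thesis
      using ss ln_action_likelihood_ratio[of ss \<pi> \<pi>'] by (simp add: pmf_positive_iff)
  qed
  have "KL_traj H x1 p \<pi> \<pi>'
      = ereal (measure_pmf.expectation ?P (\<lambda>\<tau>. ln (pmf ?P \<tau> / pmf ?Q \<tau>)))"
    unfolding KL_traj_def using * by (intro KL_dist_eq_expectation) auto
  also have "measure_pmf.expectation ?P (\<lambda>\<tau>. ln (pmf ?P \<tau> / pmf ?Q \<tau>))
      = measure_pmf.expectation ?P
          (\<lambda>(ss, z). \<Sum>(x, y)\<leftarrow>ss. ln (pmf (\<pi> x) y / pmf (\<pi>' x) y))"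
    using * by (intro integral_cong_AE) (auto simp: AE_measure_pmf_iff)
  also have "\<dots> = expected_sum p \<pi> (\<lambda>h x. KL_act (\<pi> x) (\<pi>' x)) H 1 x1"
    unfolding KL_act_def by (rule expectation_traj_sum_list[OF start])
  finally show ?thesis .
qed

end

subsection \<open>Convergence of the iterates\<close>

text \<open>Equality of supports is assumed here because it is established by the very induction
  over \<open>t\<close> that applies this lemma.\<close>

lemma rlhf_iterate_Suc:
  assumes "rlhf_iterates H X p \<mu> \<alpha> r \<eta> \<pi>" "t \<ge> 1" "h \<in> {1..H}" "x \<in> X h"
    and "set_pmf (\<pi> t x) = set_pmf (\<mu> x)"
  shows "\<pi> (Suc t) x = tilt (\<pi> t x)
    (\<lambda>y. \<eta> t * (Q_reg H p \<mu> \<alpha> r (\<pi> t) h x y - \<alpha> * ln (pmf (\<pi> t x) y / pmf (\<mu> x) y)))"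
proof (rule is_arg_max_update_objective[OF assms(5)])
  show "is_arg_max
      (update_objective \<alpha> (\<eta> t) (\<mu> x) (\<pi> t x) (Q_reg H p \<mu> \<alpha> r (\<pi> t) h x))
      (\<lambda>q. set_pmf q \<subseteq> set_pmf (\<mu> x) \<and> set_pmf q \<subseteq> set_pmf (\<pi> t x)) (\<pi> (Suc t) x)"
    using assms(1-4) unfolding rlhf_iterates_def Suc_eq_plus1 by blast
qed

text \<open>Up to a constant, \<open>\<alpha> * ln (\<pi> t x y / \<mu> x y)\<close> is a convex combination of the earlier Q-values,
  hence it stays in an interval of the same length as theirs.\<close>
lemma rlhf_iterate_invariant:
  assumes iter: "rlhf_iterates H X p \<mu> \<alpha> r \<eta> \<pi>"
    and \<eta>: "\<And>t. 1 \<le> t \<Longrightarrow> 0 \<le> \<alpha> * \<eta> t \<and> \<alpha> * \<eta> t \<le> 1"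
    and x: "h \<in> {1..H}" "x \<in> X h"
    and Q: "\<And>t y. 1 \<le> t \<Longrightarrow> \<bar>Q_reg H p \<mu> \<alpha> r (\<pi> t) h x y\<bar> \<le> B"
    and "t \<ge> 1"
  shows "set_pmf (\<pi> t x) = set_pmf (\<mu> x)
    \<and> (\<exists>k. \<forall>y\<in>set_pmf (\<mu> x). \<bar>\<alpha> * ln (pmf (\<pi> t x) y / pmf (\<mu> x) y) - k\<bar> \<le> B)"
  using \<open>t \<ge> 1\<close>
proof (induction t rule: nat_induct_at_least)
  case base
  have "\<pi> 1 x = \<mu> x"
    using iter x unfolding rlhf_iterates_def by blast
  \<comment> \<open>Initially the log ratio vanishes on the support, so the centre \<open>0\<close>
    works once \<open>B\<close> is known to be nonnegative.\<close>
  moreover have "0 \<le> B"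
    using Q[of 1] by (meson abs_ge_zero order_refl order_trans)
  ultimately show ?case
    by (auto simp: set_pmf_iff intro!: exI[of _ 0])
next
  case (Suc t)
  then obtain k where supp: "set_pmf (\<pi> t x) = set_pmf (\<mu> x)"
    and k: "\<And>y. y \<in> set_pmf (\<mu> x) \<Longrightarrow> \<bar>\<alpha> * ln (pmf (\<pi> t x) y / pmf (\<mu> x) y) - k\<bar> \<le> B"
    by blast
  have eq: "\<pi> (Suc t) x = tilt (\<pi> t x)
    (\<lambda>y. \<eta> t * (Q_reg H p \<mu> \<alpha> r (\<pi> t) h x y - \<alpha> * ln (pmf (\<pi> t x) y / pmf (\<mu> x) y)))"
    using rlhf_iterate_Suc[OF iter Suc.hyps x supp] .
  show ?case
    using log_ratio_tilt[OF supp _ _ Q[OF Suc.hyps] k] \<eta>[OF Suc.hyps] supp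
    unfolding eq by (auto intro!: exI)
qed

theorem theoremB6:
  fixes H :: nat and X :: "nat \<Rightarrow> 'x set" and x1 :: 'x
    and p :: "'x \<Rightarrow> 'y::finite \<Rightarrow> 'x pmf"
    and \<mu> \<pi>s :: "('x, 'y) policy" and \<pi> :: "nat \<Rightarrow> ('x, 'y) policy"
    and \<alpha> B :: real and r :: "'x \<Rightarrow> real"
  assumes "finite_horizon_mdp H X x1 p"
    and "\<alpha> > 0"
    and "optimal_policy H X p \<mu> \<alpha> r \<pi>s"
    and "rlhf_iterates H X p \<mu> \<alpha> r (\<lambda>t. 2 / (\<alpha> * (real t + 2))) \<pi>"
    and "\<And>t h x y. t \<ge> 1 \<Longrightarrow> h \<in> {1..H} \<Longrightarrow> x \<in> X h \<Longrightarrow>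
           \<bar>Q_reg H p \<mu> \<alpha> r (\<pi> t) h x y\<bar> \<le> B"
  shows "\<forall>t\<ge>1. KL_traj H x1 p \<pi>s (\<pi> t) \<le> ereal (32 * real H * B\<^sup>2 / (\<alpha>\<^sup>2 * (real t + 1)))"
proof -
  interpret finite_horizon_mdp H X x1 p
    by fact
  note start = order_refl[of "1::nat"] add.commute[of 1 H] initial_state
  define \<eta> where "\<eta> t = 2 / (\<alpha> * (real t + 2))" for t :: nat
  have iter: "rlhf_iterates H X p \<mu> \<alpha> r \<eta> \<pi>"
    using assms(4) unfolding \<eta>_def .
  have \<alpha>\<eta>: "\<alpha> * \<eta> t = 2 / (real t + 2)" and \<eta>_pos: "\<eta> t > 0" for t
    using \<open>\<alpha> > 0\<close> by (simp_all add: \<eta>_def)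
  have inv: "set_pmf (\<pi> t x) = set_pmf (\<mu> x)
      \<and> (\<exists>k. \<forall>y\<in>set_pmf (\<mu> x). \<bar>\<alpha> * ln (pmf (\<pi> t x) y / pmf (\<mu> x) y) - k\<bar> \<le> B)"
    if "t \<ge> 1" "h \<in> {1..H}" "x \<in> X h" for t h x
    using that by (intro rlhf_iterate_invariant[OF iter]) (auto simp: \<alpha>\<eta> assms(5))
  have opt: "is_arg_max (\<lambda>\<pi>. V_reg H p \<mu> \<alpha> r \<pi> 1 x1) (admissible H X \<mu>) \<pi>s"
    using assms(3) initial_state unfolding optimal_policy_def by force
  have supp_\<pi>s: "set_pmf (\<pi>s x) \<subseteq> set_pmf (\<mu> x)" if "h \<in> {1..H}" "x \<in> X h" for h x
    using opt that unfolding is_arg_max_def admissible_def by (auto simp: set_pmf_iff)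

  define adv where "adv t = expected_sum p \<pi>s (advantage H p \<mu> \<alpha> r \<pi>s (\<pi> t)) H 1 x1" for t
  \<comment> \<open>\<open>adv t\<close> is the value gap at \<open>x1\<close> between
    \<open>\<pi>s\<close> and \<open>\<pi> t\<close>, and equality of supports makes
    \<open>\<pi> t\<close> an admissible competitor.\<close>
  have adv_nonneg: "adv t \<ge> 0" if "t \<ge> 1" for t
  proof -
    have "admissible H X \<mu> (\<pi> t)"
      using inv[OF that] unfolding admissible_def by (auto simp: set_pmf_iff[symmetric] pmf_eq_0_set_pmf)
    then show ?thesis
      using opt unfolding adv_def performance_difference[OF start] is_arg_max_def by force
  qed

  \<comment> \<open>The rate \<open>\<theta>\<close> is left free to serve both for
    \<open>\<eta> t\<close> and for \<open>2 / \<alpha>\<close>. The right-hand side has the affine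
    shape that \<open>expected_sum_affine\<close> sums.\<close>
  have step: "KL_act (\<pi>s x) (tilt (\<pi> t x)
        (\<lambda>y. \<theta> * (Q_reg H p \<mu> \<alpha> r (\<pi> t) h x y - \<alpha> * ln (pmf (\<pi> t x) y / pmf (\<mu> x) y))))
      \<le> (1 - \<alpha> * \<theta>) * KL_act (\<pi>s x) (\<pi> t x)
        + (- \<theta>) * advantage H p \<mu> \<alpha> r \<pi>s (\<pi> t) h x + 2 * \<theta>\<^sup>2 * B\<^sup>2"
    if "t \<ge> 1" "\<theta> > 0" "h \<in> {1..H}" "x \<in> X h" for \<theta> t h x
  proof -
    note prems = that
    obtain k where "\<And>y. y \<in> set_pmf (\<mu> x)
        \<Longrightarrow> \<bar>\<alpha> * ln (pmf (\<pi> t x) y / pmf (\<mu> x) y) - k\<bar> \<le> B"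
      using inv[OF prems(1,3,4)] by blast
    from mirror_step[OF _ supp_\<pi>s[OF prems(3,4)] \<open>\<theta> > 0\<close> assms(5)[OF prems(1,3,4)] this]
    show ?thesis
      using inv[OF prems(1,3,4)] by (simp add: advantage_def)
  qed

  define K where "K t = expected_sum p \<pi>s (\<lambda>h x. KL_act (\<pi>s x) (\<pi> t x)) H 1 x1" for t
  define D where "D = real H * B\<^sup>2 / \<alpha>\<^sup>2"
  have "D \<ge> 0"
    by (simp add: D_def)

  have K_1: "K 1 \<le> 8 * D"
  proof -
    \<comment> \<open>The summand with coefficient \<open>0\<close> only fills the affine shape. The
      tilt below is not an iterate; only the nonnegativity of its divergence enters, and the
      constant is \<open>2 * (2 / \<alpha>)\<^sup>2 = 8 / \<alpha>\<^sup>2\<close>.\<close>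
    have "KL_act (\<pi>s x) (\<pi> 1 x)
        \<le> 0 * KL_act (\<pi>s x) (\<pi> 1 x) + (- (2 / \<alpha>)) * advantage H p \<mu> \<alpha> r \<pi>s (\<pi> 1) h x
          + 8 * B\<^sup>2 / \<alpha>\<^sup>2" if "h \<in> {1..H}" "x \<in> X h" for h x
    proof -
      let ?tilt = "tilt (\<pi> 1 x) (\<lambda>y. 2 / \<alpha> *
        (Q_reg H p \<mu> \<alpha> r (\<pi> 1) h x y - \<alpha> * ln (pmf (\<pi> 1 x) y / pmf (\<mu> x) y)))"
      have "0 \<le> KL_act (\<pi>s x) ?tilt"
        using supp_\<pi>s[OF that] inv[OF _ that, of 1] by (intro KL_act_nonneg) simp
      then show ?thesis
        using step[OF _ _ that, of 1 "2 / \<alpha>"] \<open>\<alpha> > 0\<close> by (simp add: power_divide)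
    qed
    from expected_sum_mono[OF start this, where \<pi> = \<pi>s]
    have "K 1 \<le> - (2 / \<alpha>) * adv 1 + 8 * B\<^sup>2 / \<alpha>\<^sup>2 * real H"
      unfolding expected_sum_affine[OF start] K_def adv_def by simp
    moreover have "2 / \<alpha> * adv 1 \<ge> 0"
      using adv_nonneg[of 1] \<open>\<alpha> > 0\<close> by simp
    ultimately show ?thesis
      by (simp add: D_def mult.commute mult.left_commute)
  qed

  have K_Suc: "K (Suc t) \<le> real t / (real t + 2) * K t + 8 * D / (real t + 2)\<^sup>2" if "t \<ge> 1" for t
  proof -
    have "KL_act (\<pi>s x) (\<pi> (Suc t) x) \<le> (1 - \<alpha> * \<eta> t) * KL_act (\<pi>s x) (\<pi> t x)
        + (- \<eta> t) * advantage H p \<mu> \<alpha> r \<pi>s (\<pi> t) h x + 2 * (\<eta> t)\<^sup>2 * B\<^sup>2"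
      if "h \<in> {1..H}" "x \<in> X h" for h x
      using step[OF \<open>t \<ge> 1\<close> \<eta>_pos that] inv[OF \<open>t \<ge> 1\<close> that]
      by (subst rlhf_iterate_Suc[OF iter \<open>t \<ge> 1\<close> that]) auto
    from expected_sum_mono[OF start this, where \<pi> = \<pi>s]
    have "K (Suc t) \<le> (1 - \<alpha> * \<eta> t) * K t - \<eta> t * adv t + 2 * (\<eta> t)\<^sup>2 * B\<^sup>2 * real H"
      unfolding expected_sum_affine[OF start] K_def adv_def by simp
    moreover have "\<eta> t * adv t \<ge> 0"
      using adv_nonneg[OF that] \<eta>_pos[of t] by simp
    moreover have "1 - \<alpha> * \<eta> t = real t / (real t + 2)"
      unfolding \<alpha>\<eta> by (simp add: field_simps)
    moreover have "2 * (\<eta> t)\<^sup>2 * B\<^sup>2 * real H = 8 * D / (real t + 2)\<^sup>2"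
      by (simp add: \<eta>_def D_def power_divide power_mult_distrib)
    ultimately show ?thesis
      by simp
  qed

  have K: "K t \<le> 32 * D / (real t + 1)" if "t \<ge> 1" for t
    using that
  proof (induction t rule: nat_induct_at_least)
    case base
    then show ?case
      using K_1 \<open>D \<ge> 0\<close> by simp
  next
    case (Suc t)
    have "K (Suc t) \<le> real t / (real t + 2) * (32 * D / (real t + 1)) + 8 * D / (real t + 2)\<^sup>2"
      using K_Suc[OF Suc.hyps] mult_left_mono[OF Suc.IH, of "real t / (real t + 2)"] by simp
    \<comment> \<open>Enlarging the error term gives both fractions the denominator
      \<open>(t + 2) * (t + 1)\<close>; the numerators add up to \<open>32 * D * (t + 1)\<close>, so
      \<open>t + 1\<close> cancels.\<close>
    also have "\<dots> \<le> real t / (real t + 2) * (32 * D / (real t + 1))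
        + 32 * D / ((real t + 2) * (real t + 1))"
      using \<open>D \<ge> 0\<close> unfolding power2_eq_square by (intro add_left_mono frac_le mult_left_mono) auto
    also have "\<dots> = 32 * D / (real (Suc t) + 1)"
      by (simp add: divide_simps) (simp add: algebra_simps)
    finally show ?case .
  qed

  show ?thesis
  proof (intro allI impI)
    fix t :: nat
    assume "t \<ge> 1"
    then have "KL_traj H x1 p \<pi>s (\<pi> t) = ereal (K t)"
      unfolding K_def using inv supp_\<pi>s by (intro KL_traj_eq_expected_sum) blast
    then show "KL_traj H x1 p \<pi>s (\<pi> t) \<le> ereal (32 * real H * B\<^sup>2 / (\<alpha>\<^sup>2 * (real t + 1)))"
      using K[OF \<open>t \<ge> 1\<close>] by (simp add: D_def)
  qed
qed

end
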